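(* Consider the following algorithm for Risky Stochastic Knapsack. Sort the items so that $\frac{w_1}{\mu_1}\ge \frac{w_2}{\mu_2}\ge\cdots\ge\frac{w_n}{\mu_n}$. Starting from $B=\emptyset$ and $\ell=1$, while $\mu(B)+\mu_\ell\le 0.5$, add item $\ell$ to $B$ and increase $\ell$ by one. Set $\alpha=\mu(B)$, $\beta=\alpha+\mu_\ell$, $\gamma=w_\ell/\Phi(1)$, and $o_1=\alpha(1-\alpha)$, $o_2=(\beta-\gamma)(1-\alpha)$, $o_3=\gamma$, $o_4=\beta(1-\beta)$. Let $j=\arg\max_{i\in\{1,2,3,4\}} o_i$. If $j\in\{1,2\}$, the output non-adaptive policy inserts all items of $B$; if $j=3$, it inserts only item $\ell$; if $j=4$, it inserts all items of $B\cup\{\ell\}$. Then for every instance $I$ of Risky Stochastic Knapsack, $\mathrm{ADAPT}(I)$ is at most $2\phi^3\approx 8.47$ times the expected value of the policy output by this algorithm, where $\phi=\frac{1+\sqrt5}{2}$ is the golden ratio.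
   Context: Stochastic Knapsack: an instance consists of $n$ items; item $i$ has a deterministic value $v_i\ge 0$ and a random nonnegative size $S_i$ drawn from a known distribution, independently across items. The knapsack capacity is $1$. A policy inserts items one at a time (each at most once) and may stop at any time; execution ends when the policy stops or at the first overflow, i.e., when the total realized size of inserted items exceeds $1$. In Risky Stochastic Knapsack, an overflow yields total value $0$; otherwise the policy receives the sum of the values of the inserted items. A policy is non-adaptive if its sequence of insertions is fixed in advance; an adaptive policy may choose each next action based on the realized sizes observed so far. $\mathrm{ADAPT}(I)$ denotes the maximum expected value over all (fully adaptive) policies for instance $I$. The effective value of item $i$ is $w_i=v_i\Pr(S_i\le 1)$; its mean truncated size is $\mu_i=\mathbb{E}[\min(S_i,1)]$; for a set $A$, $\mu(A)=\sum_{i\in A}\mu_i$. For $t\ge 0$, $\Phi(t)=\max\{\sum_i x_iw_i : \sum_i x_i\mu_i\le t,\ x_i\in[0,1]\}$. *)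

theory Defs
  imports "HOL-Probability.Probability" "HOL-Library.While_Combinator"
begin

text \<open>
  The items of an instance are the indices below \<open>num_items\<close>. Only the distributions of
  the sizes are recorded; independence is built into the joint distribution \<open>sizes\<close>.
\<close>

record knapsack =
  num_items :: nat
  item_value :: "nat \<Rightarrow> real"
  size_dist :: "nat \<Rightarrow> real measure"

definition knapsack_instance :: "knapsack \<Rightarrow> bool" where
  "knapsack_instance I \<longleftrightarrow>
     (\<forall>i < num_items I. 0 \<le> item_value I i \<and> real_distribution (size_dist I i) \<and>
        (AE s in size_dist I i. 0 \<le> s))"

definition sizes :: "knapsack \<Rightarrow> (nat \<Rightarrow> real) measure" where
  "sizes I = Pi\<^sub>M {..<num_items I} (size_dist I)"

text \<open>
  A policy maps the history (inserted items with their realized sizes, oldest first) to the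
  next item, or to \<open>None\<close> in order to stop. The history may end with the item that overflowed
  the knapsack; execution does not continue from there. A valid policy inserts each item at
  most once, hence has stopped after \<open>num_items\<close> steps.
\<close>

type_synonym history = "(nat \<times> real) list"
type_synonym policy = "history \<Rightarrow> nat option"

definition overflow :: "history \<Rightarrow> bool" where
  "overflow h \<longleftrightarrow> sum_list (map snd h) > 1"

fun execute :: "policy \<Rightarrow> (nat \<Rightarrow> real) \<Rightarrow> nat \<Rightarrow> history" where
  "execute \<pi> s 0 = []"
| "execute \<pi> s (Suc k) =
     (let h = execute \<pi> s k in
      if overflow h then h
      else case \<pi> h of None \<Rightarrow> h | Some i \<Rightarrow> h @ [(i, s i)])"

definition risky_payoff :: "knapsack \<Rightarrow> policy \<Rightarrow> (nat \<Rightarrow> real) \<Rightarrow> real" where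
  "risky_payoff I \<pi> s =
     (let h = execute \<pi> s (num_items I) in
      if overflow h then 0 else sum_list (map (item_value I \<circ> fst) h))"

definition policy_value :: "knapsack \<Rightarrow> policy \<Rightarrow> real" where
  "policy_value I \<pi> = (\<integral>s. risky_payoff I \<pi> s \<partial>sizes I)"

text \<open>
  Adaptive policies. The second condition says that, for each fixed sequence of inserted items,
  the next action is a Borel function of their realized sizes; it makes the payoff measurable.
\<close>

definition policies :: "knapsack \<Rightarrow> policy set" where
  "policies I =
     {\<pi>. (\<forall>h i. \<pi> h = Some i \<longrightarrow> i < num_items I \<and> i \<notin> fst ` set h) \<and>
         (\<forall>is. distinct is \<and> set is \<subseteq> {..<num_items I} \<longrightarrow>
            (\<lambda>s. \<pi> (map (\<lambda>i. (i, s i)) is))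
              \<in> measurable (Pi\<^sub>M {..<num_items I} (\<lambda>_. borel)) (count_space UNIV))}"

definition ADAPT :: "knapsack \<Rightarrow> real" where
  "ADAPT I = (SUP \<pi>\<in>policies I. policy_value I \<pi>)"

text \<open>The non-adaptive policy that inserts the items of the list in the given order.\<close>

definition nonadaptive :: "nat list \<Rightarrow> policy" where
  "nonadaptive xs h = List.find (\<lambda>i. i \<notin> fst ` set h) xs"

definition eff_value :: "knapsack \<Rightarrow> nat \<Rightarrow> real" where
  "eff_value I i = item_value I i * measure (size_dist I i) {..1}"

definition mean_size :: "knapsack \<Rightarrow> nat \<Rightarrow> real" where
  "mean_size I i = (\<integral>s. min s 1 \<partial>size_dist I i)"

definition Phi :: "knapsack \<Rightarrow> real \<Rightarrow> real" where
  "Phi I t =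
     Sup {(\<Sum>i<num_items I. x i * eff_value I i) | x.
            (\<Sum>i<num_items I. x i * mean_size I i) \<le> t \<and> (\<forall>i<num_items I. x i \<in> {0..1})}"

text \<open>
  Ratios are taken in \<open>ennreal\<close>, so that an item of positive effective value and mean
  truncated size 0 has ratio \<open>\<infinity>\<close>. For an item with \<open>eff_value = mean_size = 0\<close> (which has
  value 0) the ratio is 0.
\<close>

definition ratio :: "knapsack \<Rightarrow> nat \<Rightarrow> ennreal" where
  "ratio I i = ennreal (eff_value I i) / ennreal (mean_size I i)"

definition sorted_items :: "knapsack \<Rightarrow> nat list \<Rightarrow> bool" where
  "sorted_items I xs \<longleftrightarrow>
     distinct xs \<and> set xs = {..<num_items I} \<and> sorted_wrt (\<lambda>i j. ratio I i \<ge> ratio I j) xs"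

text \<open>
  The pair \<open>(B, l)\<close> reached by the greedy loop on the sorted list \<open>xs\<close>; positions are counted
  from 0, and the loop also ends when there are no items left.
\<close>

definition greedy :: "knapsack \<Rightarrow> nat list \<Rightarrow> nat set \<times> nat" where
  "greedy I xs =
     while (\<lambda>(B, l). l < length xs \<and> sum (mean_size I) B + mean_size I (xs ! l) \<le> 1/2)
           (\<lambda>(B, l). (insert (xs ! l) B, Suc l))
           ({}, 0)"

definition score :: "knapsack \<Rightarrow> nat set \<Rightarrow> nat \<Rightarrow> nat \<Rightarrow> real" where
  "score I B i j =
     (let \<alpha> = sum (mean_size I) B; \<beta> = \<alpha> + mean_size I i; \<gamma> = eff_value I i / Phi I 1 in
      if j = 1 then \<alpha> * (1 - \<alpha>)
      else if j = 2 then (\<beta> - \<gamma>) * (1 - \<alpha>)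
      else if j = 3 then \<gamma>
      else \<beta> * (1 - \<beta>))"

definition candidate :: "nat set \<Rightarrow> nat \<Rightarrow> nat \<Rightarrow> nat set" where
  "candidate B i j = (if j \<in> {1, 2} then B else if j = 3 then {i} else insert i B)"

text \<open>
  \<open>algorithm_output I ys\<close>: on instance \<open>I\<close> the algorithm may output the non-adaptive policy
  inserting \<open>ys\<close>. It is a relation because ties (in sorting and in the arg max) and the order in
  which the chosen items are inserted are left open. If the greedy loop has consumed all items
  then there is no item to compare with, and \<open>B\<close>, which contains all the items, is inserted.
\<close>

definition algorithm_output :: "knapsack \<Rightarrow> nat list \<Rightarrow> bool" where
  "algorithm_output I ys \<longleftrightarrow>
     (\<exists>xs B l. sorted_items I xs \<and> greedy I xs = (B, l) \<and> distinct ys \<and>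
        (if l = length xs then set ys = B
         else \<exists>j. is_arg_max (score I B (xs ! l)) (\<lambda>j. j \<in> {1, 2, 3, 4}) j \<and>
                  set ys = candidate B (xs ! l) j))"

definition golden_ratio :: real where
  "golden_ratio = (1 + sqrt 5) / 2"

end

theory Submission
  imports Defs
begin

text \<open>
  If \<open>x\<^sub>i\<close> is the probability that an adaptive policy inserts item \<open>i\<close>, then independence of that
  event and the size of \<open>i\<close> makes \<open>x\<close> a feasible fractional solution of capacity 2, whose value
  bounds that of the policy; hence \<open>ADAPT \<le> Phi 2 \<le> 2 * Phi 1\<close> by concavity. Conversely, inserting
  a set \<open>A\<close> earns at least \<open>w(A) * (1 - \<mu>(A))\<close> by Markov's inequality, and the greedy prefixes
  \<open>A\<close> satisfy \<open>w(A) \<ge> \<mu>(A) * Phi 1\<close> as long as \<open>\<mu>(A) \<le> 1\<close>. So the output earns at least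
  \<open>Phi 1\<close> times the smallest possible maximal score, which is \<open>sqrt 5 - 2\<close>, the inverse of the
  cube of the golden ratio.
\<close>

section \<open>Executions\<close>

definition inserted :: "policy \<Rightarrow> (nat \<Rightarrow> real) \<Rightarrow> nat \<Rightarrow> nat list" where
  "inserted \<pi> s k = map fst (execute \<pi> s k)"

text \<open>The item list is tracked apart from the sizes: it takes only finitely many values, and
  \<open>execute_eq\<close> rebuilds the history from it. For a fixed list, a step is a function of
  \<open>s\<close> alone, which is the form that the measurability proof uses.\<close>

definition insert_step :: "policy \<Rightarrow> nat list \<Rightarrow> (nat \<Rightarrow> real) \<Rightarrow> nat list" where
  "insert_step \<pi> is s =
     (if sum_list (map s is) > 1 then is
      else case \<pi> (map (\<lambda>i. (i, s i)) is) of None \<Rightarrow> is | Some i \<Rightarrow> is @ [i])"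

lemma execute_eq: "map (\<lambda>i. (i, s i)) (inserted \<pi> s k) = execute \<pi> s k"
  unfolding inserted_def
  by (induction k) (auto simp: Let_def split: option.split)

lemma snd_execute: "map snd (execute \<pi> s k) = map s (inserted \<pi> s k)"
  by (simp only: execute_eq[symmetric] map_map) (simp add: o_def)

lemma inserted_0 [simp]: "inserted \<pi> s 0 = []"
  by (simp add: inserted_def)

lemma inserted_Suc: "inserted \<pi> s (Suc k) = insert_step \<pi> (inserted \<pi> s k) s"
proof -
  have "insert_step \<pi> (inserted \<pi> s k) s =
    (if overflow (execute \<pi> s k) then inserted \<pi> s k
     else case \<pi> (execute \<pi> s k) of None \<Rightarrow> inserted \<pi> s k | Some i \<Rightarrow> inserted \<pi> s k @ [i])"
    by (simp add: insert_step_def overflow_def snd_execute execute_eq)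
  then show ?thesis
    by (auto simp: inserted_def Let_def split: option.split)
qed

lemma risky_payoff_eq:
  "risky_payoff I \<pi> s =
     (let is = inserted \<pi> s (num_items I) in
      if sum_list (map s is) > 1 then 0 else sum_list (map (item_value I) is))"
  by (simp add: risky_payoff_def Let_def overflow_def snd_execute inserted_def)

definition item_seqs :: "knapsack \<Rightarrow> nat list set" where
  "item_seqs I = {is. distinct is \<and> set is \<subseteq> {..<num_items I}}"

lemma inserted_in_item_seqs:
  assumes "\<pi> \<in> policies I"
  shows "inserted \<pi> s k \<in> item_seqs I"
proof (induction k)
  case 0
  then show ?case by (simp add: item_seqs_def)
next
  case (Suc k)
  have "i < num_items I \<and> i \<notin> set is" if "\<pi> (map (\<lambda>i. (i, s i)) is) = Some i" for i "is"
    using assms that unfolding policies_def by (force simp: image_image)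
  with Suc show ?case
    by (auto simp: inserted_Suc insert_step_def item_seqs_def split: option.split)
qed

lemma sum_item_seq:
  assumes "is \<in> item_seqs I"
  shows "sum_list (map f is) = (\<Sum>i<num_items I. of_bool (i \<in> set is) * (f i :: real))"
proof -
  have "sum_list (map f is) = sum f (set is)"
    using assms by (simp add: item_seqs_def sum_list_distinct_conv_sum_set)
  also have "\<dots> = (\<Sum>i<num_items I. if i \<in> set is then f i else 0)"
    using assms by (simp add: item_seqs_def sum.inter_restrict[symmetric] inf.absorb2)
  also have "\<dots> = (\<Sum>i<num_items I. of_bool (i \<in> set is) * f i)"
    by (intro sum.cong) auto
  finally show ?thesis .
qed

text \<open>The item that overflows the knapsack counts at most 1.\<close>

lemma sum_inserted_truncated_le:
  "sum_list (map (\<lambda>i. min (s i) 1) (inserted \<pi> s k)) \<le> (2 :: real)"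
proof (induction k)
  case (Suc k)
  have "sum_list (map (\<lambda>i. min (s i) 1) is) \<le> sum_list (map s is)" for "is"
    by (intro sum_list_mono) auto
  \<comment> \<open>An item is only added while the true total is at most 1, so the truncated total
    is then at most 1 as well and grows by at most 1.\<close>
  then have "sum_list (map (\<lambda>i. min (s i) 1) is) + min (s j) 1 \<le> 2"
    if "\<not> sum_list (map s is) > 1" for "is" j
    using that by (smt (verit))
  with Suc show ?case
    by (auto simp: inserted_Suc insert_step_def split: option.split)
qed auto

text \<open>Whether \<open>i\<close> gets inserted is decided before the size of \<open>i\<close> is observed.\<close>

lemma inserted_indep:
  assumes "\<And>m. m \<noteq> i \<Longrightarrow> s m = s' m"
  shows "inserted \<pi> s k = inserted \<pi> s' k \<or> i \<in> set (inserted \<pi> s k) \<and> i \<in> set (inserted \<pi> s' k)"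
proof (induction k)
  case (Suc k)
  \<comment> \<open>Both runs see the same sizes until \<open>i\<close> is inserted, and then both
    insert it. Afterwards they may diverge, but since lists only grow, \<open>i\<close> stays in
    both.\<close>
  have mono: "set is \<subseteq> set (insert_step \<pi> is s)" for "is" s
    by (auto simp: insert_step_def split: option.split)
  show ?case
  proof (cases "i \<in> set (inserted \<pi> s k)")
    case True
    then show ?thesis using Suc mono by (fastforce simp: inserted_Suc)
  next
    case False
    then have eq: "inserted \<pi> s k = inserted \<pi> s' k" using Suc by auto
    have "map s (inserted \<pi> s k) = map s' (inserted \<pi> s k)"
      "map (\<lambda>i. (i, s i)) (inserted \<pi> s k) = map (\<lambda>i. (i, s' i)) (inserted \<pi> s k)"
      using False assms by (auto intro!: map_cong) metis+
    then have "inserted \<pi> s (Suc k) = inserted \<pi> s' (Suc k)"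
      unfolding inserted_Suc insert_step_def eq[symmetric] by presburger
    then show ?thesis ..
  qed
qed auto

lemma inserted_fun_upd:
  "i \<in> set (inserted \<pi> (s(i := y)) k) \<longleftrightarrow> i \<in> set (inserted \<pi> (s(i := z)) k)"
  using inserted_indep[of i "s(i := y)" "s(i := z)" \<pi> k] by auto

section \<open>The joint distribution of the sizes\<close>

locale valid_knapsack =
  fixes I :: knapsack
  assumes valid: "knapsack_instance I"
begin

abbreviation "n \<equiv> num_items I"
abbreviation "v \<equiv> item_value I"
abbreviation "w \<equiv> eff_value I"
abbreviation "\<mu> \<equiv> mean_size I"

text \<open>The product measure locales ask for a probability space at every index.\<close>

definition sizeD :: "nat \<Rightarrow> real measure" where
  "sizeD i = (if i < n then size_dist I i else return borel 0)"

lemma real_distribution_sizeD: "real_distribution (sizeD i)"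
proof (cases "i < n")
  case True
  then show ?thesis using valid by (simp add: sizeD_def knapsack_instance_def)
next
  case False
  interpret prob_space "return borel (0 :: real)" by (rule prob_space_return) simp
  show ?thesis using False by (simp add: sizeD_def, unfold_locales) auto
qed

sublocale D: real_distribution "sizeD i" for i
  by (rule real_distribution_sizeD)

sublocale P: product_prob_space sizeD "{..<n}"
  by unfold_locales

lemma sizes_eq: "sizes I = Pi\<^sub>M {..<n} sizeD"
  unfolding sizes_def by (intro PiM_cong) (auto simp: sizeD_def)

sublocale S: prob_space "sizes I"
  unfolding sizes_eq by (intro prob_space_PiM D.prob_space_axioms)

lemma sets_sizes [measurable_cong]: "sets (sizes I) = sets (Pi\<^sub>M {..<n} (\<lambda>_. borel))"
  unfolding sizes_eq by (intro sets_PiM_cong) auto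

lemma value_nonneg: "i < n \<Longrightarrow> 0 \<le> v i"
  using valid by (simp add: knapsack_instance_def)

lemma AE_sizeD_nonneg:
  assumes "i < n"
  shows "AE x in sizeD i. 0 \<le> x"
proof -
  have "AE x in size_dist I i. 0 \<le> x" using valid assms by (simp add: knapsack_instance_def)
  then show ?thesis using assms by (simp only: sizeD_def if_True)
qed

lemma AE_sizes_nonneg: "AE s in sizes I. \<forall>i\<in>{..<n}. 0 \<le> s i"
  unfolding sizes_eq
  by (intro AE_finite_allI AE_PiM_component AE_sizeD_nonneg D.prob_space_axioms) auto

lemma integrable_size:
  assumes "i < n" "integrable (sizeD i) (g :: real \<Rightarrow> real)"
  shows "integrable (sizes I) (\<lambda>s. g (s i))"
proof -
  have "distr (sizes I) (sizeD i) (\<lambda>s. s i) = sizeD i"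
    unfolding sizes_eq using assms
    by (intro distr_PiM_component) (auto intro: D.prob_space_axioms)
  with assms show ?thesis
    by (intro integrable_distr[where M = "sizes I" and M' = "sizeD i" and T = "\<lambda>s. s i"]) auto
qed

text \<open>Fubini with coordinate \<open>i\<close> as the inner variable: \<open>E\<close> does not
  see that coordinate, so its indicator leaves the inner integral. It is applied to the event that a
  policy inserts \<open>i\<close>.\<close>

lemma integral_indep:
  fixes g :: "real \<Rightarrow> real"
  assumes i: "i < n"
    and E: "\<And>s y z. E (s(i := y)) \<longleftrightarrow> E (s(i := z))"
    and E_meas [measurable]: "Measurable.pred (sizes I) E"
    and g: "integrable (sizeD i) g"
  shows "integrable (sizes I) (\<lambda>s. of_bool (E s) * g (s i))"
    and "(\<integral>s. of_bool (E s) * g (s i) \<partial>sizes I) =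
         S.prob {s \<in> space (sizes I). E s} * (\<integral>x. g x \<partial>sizeD i)"
proof -
  let ?N = "{..<n} - {i}"
  have ins: "insert i ?N = {..<n}" using i by auto
  have int: "integrable (sizes I) (\<lambda>s. of_bool (E s) * h (s i))"
    if h: "integrable (sizeD i) h" for h :: "real \<Rightarrow> real"
  proof (rule Bochner_Integration.integrable_bound[OF integrable_size[OF i h]])
    have [measurable]: "(\<lambda>s. h (s i)) \<in> borel_measurable (sizes I)"
      using integrable_size[OF i h] by simp
    have [measurable]: "(\<lambda>s. of_bool (E s) :: real) \<in> borel_measurable (sizes I)"
      unfolding of_bool_def by measurable
    show "(\<lambda>s. of_bool (E s) * h (s i)) \<in> borel_measurable (sizes I)" by measurable
  qed auto
  show "integrable (sizes I) (\<lambda>s. of_bool (E s) * g (s i))" by (rule int[OF g])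
  \<comment> \<open>The value 0 in \<open>x(i := 0)\<close> is an arbitrary reference point for the
    coordinate that \<open>E\<close> ignores.\<close>
  have *: "(\<integral>s. of_bool (E s) * h (s i) \<partial>sizes I) =
     (\<integral>x. of_bool (E (x(i := 0))) \<partial>Pi\<^sub>M ?N sizeD) * (\<integral>y. h y \<partial>sizeD i)"
    if h: "integrable (sizeD i) h" for h :: "real \<Rightarrow> real"
  proof -
    have eq: "of_bool (E (x(i := y))) * h ((x(i := y)) i) = of_bool (E (x(i := 0))) * h y" for x y
      using E[of x y 0] by simp
    have "(\<integral>s. of_bool (E s) * h (s i) \<partial>sizes I) =
      (\<integral>x. \<integral>y. of_bool (E (x(i := y))) * h ((x(i := y)) i) \<partial>sizeD i \<partial>Pi\<^sub>M ?N sizeD)"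
      using P.product_integral_insert[of ?N i "\<lambda>s. of_bool (E s) * h (s i)"] int[OF h]
      unfolding ins sizes_eq by simp
    also have "\<dots> = (\<integral>x. \<integral>y. of_bool (E (x(i := 0))) * h y \<partial>sizeD i \<partial>Pi\<^sub>M ?N sizeD)"
      by (simp only: eq)
    finally show ?thesis by simp
  qed
  \<comment> \<open>The instance \<open>h = 1\<close> of \<open>*\<close> identifies the remaining
    outer integral as the probability of \<open>E\<close>.\<close>
  have "S.prob {s \<in> space (sizes I). E s} = (\<integral>s. indicator {s \<in> space (sizes I). E s} s \<partial>sizes I)"
    by simp
  also have "\<dots> = (\<integral>s. of_bool (E s) * 1 \<partial>sizes I)"
    by (intro Bochner_Integration.integral_cong) (auto simp: indicator_def)
  also have "\<dots> = (\<integral>x. of_bool (E (x(i := 0))) \<partial>Pi\<^sub>M ?N sizeD)"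
    using *[of "\<lambda>_. 1"] D.prob_space[of i] by simp
  finally show "(\<integral>s. of_bool (E s) * g (s i) \<partial>sizes I) =
         S.prob {s \<in> space (sizes I). E s} * (\<integral>x. g x \<partial>sizeD i)"
    using *[OF g] by simp
qed

lemma integrable_truncated: "i < n \<Longrightarrow> integrable (sizeD i) (\<lambda>x. min x 1)"
  using AE_sizeD_nonneg[of i] by (intro D.integrable_const_bound[where B = 1]) (auto elim: AE_mp)

lemma integrable_fits: "integrable (sizeD i) (\<lambda>x. of_bool (x \<le> 1) :: real)"
  by (intro D.integrable_const_bound[where B = 1]) (auto simp: of_bool_def)

lemma mean_size_eq: "i < n \<Longrightarrow> \<mu> i = (\<integral>x. min x 1 \<partial>sizeD i)"
  by (simp add: mean_size_def sizeD_def)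

lemma eff_value_eq:
  assumes "i < n"
  shows "w i = v i * (\<integral>x. of_bool (x \<le> 1) \<partial>sizeD i)"
proof -
  have "(\<integral>x. of_bool (x \<le> 1) \<partial>sizeD i) = (\<integral>x. indicator {..1} x \<partial>sizeD i)"
    by (intro Bochner_Integration.integral_cong) (auto simp: indicator_def)
  also have "\<dots> = measure (sizeD i) {..1}" by simp
  finally show ?thesis using assms by (simp only: eff_value_def sizeD_def if_True)
qed

lemma mean_size_nonneg: "i < n \<Longrightarrow> 0 \<le> \<mu> i"
  using AE_sizeD_nonneg[of i] unfolding mean_size_eq by (intro integral_nonneg_AE) (auto elim: AE_mp)

lemma eff_value_nonneg: "i < n \<Longrightarrow> 0 \<le> w i"
  by (simp add: eff_value_def value_nonneg)

lemma eff_value_le: "i < n \<Longrightarrow> w i \<le> v i"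
  using D.prob_le_1[of i "{..1}"] value_nonneg[of i]
  by (simp add: eff_value_def sizeD_def mult_left_le)

section \<open>Measurability of the payoff\<close>

lemma finite_item_seqs: "finite (item_seqs I)"
  using finite_subset_distinct[of "{..<n}"] by (simp add: item_seqs_def conj_commute)

lemma measurable_sum_seq:
  assumes "is \<in> item_seqs I"
  shows "(\<lambda>s. sum_list (map s is)) \<in> borel_measurable (sizes I)"
proof -
  have "(\<lambda>s :: nat \<Rightarrow> real. sum_list (map s is)) = (\<lambda>s. \<Sum>i<n. of_bool (i \<in> set is) * s i)"
    by (intro ext sum_item_seq[OF assms])
  then show ?thesis by simp
qed

text \<open>Splitting over the finitely many lists reached after \<open>k\<close> steps leaves a
  fixed list, for which the definition of \<open>policies\<close> makes the next action
  measurable.\<close>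

lemma measurable_inserted:
  assumes "\<pi> \<in> policies I"
  shows "(\<lambda>s. inserted \<pi> s k) \<in> measurable (sizes I) (count_space (item_seqs I))"
proof (induction k)
  case 0
  then show ?case by (simp add: item_seqs_def)
next
  case (Suc k)
  have "(\<lambda>s. insert_step \<pi> (inserted \<pi> s k) s) \<in> measurable (sizes I) (count_space UNIV)"
  proof (rule measurable_compose_countable'[OF _ Suc])
    fix "is" assume "is": "is \<in> item_seqs I"
    have [measurable]: "(\<lambda>s. sum_list (map s is)) \<in> borel_measurable (sizes I)"
      by (rule measurable_sum_seq[OF "is"])
    have [measurable]: "(\<lambda>s. \<pi> (map (\<lambda>i. (i, s i)) is)) \<in> measurable (sizes I) (count_space UNIV)"
      using assms "is" unfolding measurable_cong_sets[OF sets_sizes refl] policies_def item_seqs_def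
      by blast
    show "(\<lambda>s. insert_step \<pi> is s) \<in> measurable (sizes I) (count_space UNIV)"
      unfolding insert_step_def by measurable
  qed (simp add: finite_item_seqs countable_finite)
  then have "(\<lambda>s. inserted \<pi> s (Suc k)) \<in> measurable (sizes I) (count_space UNIV)"
    by (simp add: inserted_Suc)
  then show ?case
    using inserted_in_item_seqs[OF assms] by (auto simp: measurable_def)
qed

lemma payoff_bounds:
  assumes "\<pi> \<in> policies I"
  shows "0 \<le> risky_payoff I \<pi> s" "risky_payoff I \<pi> s \<le> sum v {..<n}"
proof -
  have "0 \<le> sum_list (map v (inserted \<pi> s n))" "sum_list (map v (inserted \<pi> s n)) \<le> sum v {..<n}"
    unfolding sum_item_seq[OF inserted_in_item_seqs[OF assms]]
    by (intro sum_nonneg, simp add: value_nonneg) (intro sum_mono, simp add: value_nonneg)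
  then show "0 \<le> risky_payoff I \<pi> s" "risky_payoff I \<pi> s \<le> sum v {..<n}"
    by (auto simp: risky_payoff_eq Let_def)
qed

lemma integrable_payoff:
  assumes "\<pi> \<in> policies I"
  shows "integrable (sizes I) (risky_payoff I \<pi>)"
proof (rule S.integrable_const_bound)
  show "AE s in sizes I. norm (risky_payoff I \<pi> s) \<le> sum v {..<n}"
    using payoff_bounds[OF assms] by auto
  have "(\<lambda>s. (\<lambda>is s. if sum_list (map s is) > 1 then 0 else sum_list (map v is)) (inserted \<pi> s n) s)
      \<in> borel_measurable (sizes I)"
  proof (rule measurable_compose_countable'[OF _ measurable_inserted[OF assms]])
    fix "is" assume "is \<in> item_seqs I"
    note [measurable] = measurable_sum_seq[OF this]
    show "(\<lambda>s. if sum_list (map s is) > 1 then 0 else sum_list (map v is)) \<in> borel_measurable (sizes I)"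
      by measurable
  qed (simp add: finite_item_seqs countable_finite)
  then show "risky_payoff I \<pi> \<in> borel_measurable (sizes I)"
    by (simp add: risky_payoff_eq[abs_def] Let_def)
qed

section \<open>The fractional relaxation\<close>

lemma Phi_upper:
  assumes "(\<Sum>i<n. x i * \<mu> i) \<le> t" "\<And>i. i < n \<Longrightarrow> x i \<in> {0..1}"
  shows "(\<Sum>i<n. x i * w i) \<le> Phi I t"
  unfolding Phi_def
proof (rule cSup_upper)
  show "bdd_above {\<Sum>i<n. x i * w i |x. (\<Sum>i<n. x i * \<mu> i) \<le> t \<and> (\<forall>i<n. x i \<in> {0..1})}"
    by (rule bdd_aboveI[of _ "\<Sum>i<n. w i"])
       (auto intro!: sum_mono simp: mult_left_le_one_le eff_value_nonneg)
qed (use assms in auto)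

lemma Phi_least:
  assumes "0 \<le> t"
    and "\<And>x. (\<Sum>i<n. x i * \<mu> i) \<le> t \<Longrightarrow> (\<And>i. i < n \<Longrightarrow> x i \<in> {0..1}) \<Longrightarrow> (\<Sum>i<n. x i * w i) \<le> c"
  shows "Phi I t \<le> c"
  unfolding Phi_def
proof (rule cSup_least)
  have "(\<Sum>i<n. 0 * w i) \<in> {\<Sum>i<n. x i * w i |x. (\<Sum>i<n. x i * \<mu> i) \<le> t \<and> (\<forall>i<n. x i \<in> {0..1})}"
    using assms(1) by (intro CollectI exI[of _ "\<lambda>_. 0"]) auto
  then show "{\<Sum>i<n. x i * w i |x. (\<Sum>i<n. x i * \<mu> i) \<le> t \<and> (\<forall>i<n. x i \<in> {0..1})} \<noteq> {}" by blast
qed (use assms(2) in auto)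

lemma Phi_nonneg: "0 \<le> t \<Longrightarrow> 0 \<le> Phi I t"
  using Phi_upper[of "\<lambda>_. 0" t] by simp

text \<open>Halving every coordinate of a solution of capacity 2 gives one of capacity 1 with half
  the value.\<close>

lemma Phi_two_le: "Phi I 2 \<le> 2 * Phi I 1"
proof (rule Phi_least)
  fix x :: "nat \<Rightarrow> real"
  assume x: "(\<Sum>i<n. x i * \<mu> i) \<le> 2" "\<And>i. i < n \<Longrightarrow> x i \<in> {0..1}"
  have "(\<Sum>i<n. x i / 2 * w i) \<le> Phi I 1"
    using x by (intro Phi_upper) (force simp: sum_divide_distrib[symmetric])+
  then show "(\<Sum>i<n. x i * w i) \<le> 2 * Phi I 1"
    by (simp add: sum_divide_distrib[symmetric])
qed simp

text \<open>Weak duality, with \<open>r\<close> as the price of capacity.\<close>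

lemma Phi_le_threshold:
  assumes A: "A \<subseteq> {..<n}" and r: "0 \<le> r"
    and le: "\<And>i. i \<in> A \<Longrightarrow> r * \<mu> i \<le> w i"
    and ge: "\<And>i. i < n \<Longrightarrow> i \<notin> A \<Longrightarrow> w i \<le> r * \<mu> i"
  shows "Phi I 1 \<le> sum w A + r * (1 - sum \<mu> A)"
proof (rule Phi_least)
  fix x :: "nat \<Rightarrow> real"
  assume x: "(\<Sum>i<n. x i * \<mu> i) \<le> 1" "\<And>i. i < n \<Longrightarrow> x i \<in> {0..1}"
  \<comment> \<open>Lagrangian form: capacity is bought at price \<open>r\<close>, and the remaining
    linear objective is maximised coordinatewise by taking exactly \<open>A\<close>.\<close>
  have "(\<Sum>i<n. x i * w i) = (\<Sum>i<n. x i * (w i - r * \<mu> i)) + r * (\<Sum>i<n. x i * \<mu> i)"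
    by (simp add: sum_distrib_left sum.distrib[symmetric] algebra_simps)
  also have "\<dots> \<le> (\<Sum>i<n. if i \<in> A then w i - r * \<mu> i else 0) + r * 1"
  proof (intro add_mono sum_mono mult_left_mono x(1) r)
    fix i assume "i \<in> {..<n}"
    with x(2) le[of i] ge[of i] show "x i * (w i - r * \<mu> i) \<le> (if i \<in> A then w i - r * \<mu> i else 0)"
      by (auto simp: mult_left_le_one_le mult_nonneg_nonpos)
  qed
  also have "(\<Sum>i<n. if i \<in> A then w i - r * \<mu> i else 0) = sum w A - r * sum \<mu> A"
    using A by (simp add: sum.inter_restrict[symmetric] inf.absorb2 sum_subtractf sum_distrib_left)
  finally show "(\<Sum>i<n. x i * w i) \<le> sum w A + r * (1 - sum \<mu> A)"
    by (simp add: algebra_simps)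
qed simp

section \<open>Upper bound on adaptive policies\<close>

lemma policy_value_le:
  assumes \<pi>: "\<pi> \<in> policies I"
  shows "policy_value I \<pi> \<le> Phi I 2"
proof -
  let ?E = "\<lambda>i s. i \<in> set (inserted \<pi> s n)"
  define x where "x i = S.prob {s \<in> space (sizes I). ?E i s}" for i
  have E: "Measurable.pred (sizes I) (?E i)" for i
    by (rule measurable_compose[OF measurable_inserted[OF \<pi>]]) simp
  note indep = integral_indep[OF _ inserted_fun_upd E]
  \<comment> \<open>Relaxed payoff: each inserted item is credited if it fits on its own. This
    dominates the true payoff, and each summand pairs an event that ignores the size of
    \<open>i\<close> with a function of that size, so \<open>integral_indep\<close> applies.\<close>
  have "policy_value I \<pi> \<le>
    (\<integral>s. (\<Sum>i<n. v i * (of_bool (?E i s) * of_bool (s i \<le> 1))) \<partial>sizes I)"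
    unfolding policy_value_def
  proof (rule integral_mono_AE[OF integrable_payoff[OF \<pi>]])
    show "integrable (sizes I) (\<lambda>s. \<Sum>i<n. v i * (of_bool (?E i s) * of_bool (s i \<le> 1)))"
      by (intro Bochner_Integration.integrable_sum integrable_mult_right indep(1) integrable_fits) simp
    show "AE s in sizes I. risky_payoff I \<pi> s \<le> (\<Sum>i<n. v i * (of_bool (?E i s) * of_bool (s i \<le> 1)))"
      using AE_sizes_nonneg
    proof eventually_elim
      case (elim s)
      have seq: "inserted \<pi> s n \<in> item_seqs I" by (rule inserted_in_item_seqs[OF \<pi>])
      show ?case
      proof (cases "sum_list (map s (inserted \<pi> s n)) > 1")
        case True
        then show ?thesis by (auto simp: risky_payoff_eq intro!: sum_nonneg value_nonneg)
      next
        case False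
        have "s i \<le> 1" if "?E i s" for i
        proof -
          have "s i \<le> sum s (set (inserted \<pi> s n))"
            using that elim seq by (intro member_le_sum) (auto simp: item_seqs_def)
          with False seq show ?thesis
            by (simp add: item_seqs_def sum_list_distinct_conv_sum_set)
        qed
        then have "(\<Sum>i<n. of_bool (?E i s) * v i) \<le> (\<Sum>i<n. v i * (of_bool (?E i s) * of_bool (s i \<le> 1)))"
          by (intro sum_mono) simp
        then show ?thesis
          using False by (simp only: risky_payoff_eq Let_def if_False sum_item_seq[OF seq])
      qed
    qed
  qed
  also have "\<dots> = (\<Sum>i<n. x i * w i)"
    using indep[OF _ integrable_fits]
    by (subst Bochner_Integration.integral_sum) (auto simp: x_def eff_value_eq intro!: sum.cong)
  also have "\<dots> \<le> Phi I 2"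
  proof (rule Phi_upper)
    have "(\<Sum>i<n. x i * \<mu> i) = (\<integral>s. (\<Sum>i<n. of_bool (?E i s) * min (s i) 1) \<partial>sizes I)"
      using indep[OF _ integrable_truncated]
      by (subst Bochner_Integration.integral_sum) (auto simp: x_def mean_size_eq intro!: sum.cong)
    also have "\<dots> \<le> (\<integral>s. 2 \<partial>sizes I)"
    proof (rule integral_mono)
      show "integrable (sizes I) (\<lambda>s. \<Sum>i<n. of_bool (?E i s) * min (s i) 1)"
        by (intro Bochner_Integration.integrable_sum indep(1) integrable_truncated) auto
      show "(\<Sum>i<n. of_bool (?E i s) * min (s i) 1) \<le> 2" for s
        using sum_inserted_truncated_le[of s \<pi> n]
        unfolding sum_item_seq[OF inserted_in_item_seqs[OF \<pi>]] .
    qed simp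
    finally show "(\<Sum>i<n. x i * \<mu> i) \<le> 2" by (simp add: S.prob_space)
  qed (simp add: x_def)
  finally show ?thesis .
qed

lemma ADAPT_le: "policies I \<noteq> {} \<Longrightarrow> ADAPT I \<le> 2 * Phi I 1"
  unfolding ADAPT_def using policy_value_le Phi_two_le
  by (intro cSUP_least) (auto intro: order_trans)

section \<open>Non-adaptive policies\<close>

lemma nonadaptive_in_policies:
  assumes "set ys \<subseteq> {..<n}"
  shows "nonadaptive ys \<in> policies I"
proof -
  have "(\<lambda>s. nonadaptive ys (map (\<lambda>i. (i, s i)) is)) = (\<lambda>s. List.find (\<lambda>i. i \<notin> set is) ys)"
    for "is" and s :: "nat \<Rightarrow> real"
    by (simp add: nonadaptive_def image_image)
  then show ?thesis
    using assms by (auto simp: policies_def nonadaptive_def find_Some_iff image_image dest!: nth_mem)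
qed

lemma inserted_nonadaptive:
  assumes ys: "distinct ys" and s: "\<And>i. i \<in> set ys \<Longrightarrow> 0 \<le> s i" "sum s (set ys) \<le> 1"
  shows "inserted (nonadaptive ys) s k = take k ys"
proof (induction k)
  case (Suc k)
  have "sum_list (map s (take k ys)) = sum s (set (take k ys))"
    using ys by (simp add: sum_list_distinct_conv_sum_set)
  also have "\<dots> \<le> sum s (set ys)"
    using s(1) by (intro sum_mono2) (auto dest: in_set_takeD)
  finally have no_overflow: "\<not> sum_list (map s (take k ys)) > 1" using s(2) by simp
  have "nonadaptive ys (map (\<lambda>i. (i, s i)) (take k ys)) = List.find (\<lambda>i. i \<notin> set (take k ys)) ys"
    by (simp add: nonadaptive_def image_image)
  also have "\<dots> = (if k < length ys then Some (ys ! k) else None)"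
  proof (cases "k < length ys")
    case True
    have "ys ! k \<notin> set (take k ys)" "\<forall>j<k. ys ! j \<in> set (take k ys)"
      using True ys by (auto simp: in_set_conv_nth nth_eq_iff_index_eq)
    then have "List.find (\<lambda>i. i \<notin> set (take k ys)) ys = Some (ys ! k)"
      unfolding find_Some_iff using True by blast
    with True show ?thesis by simp
  next
    case False
    then show ?thesis by (auto simp: find_None_iff)
  qed
  finally show ?case
    using no_overflow Suc by (simp add: inserted_Suc insert_step_def take_Suc_conv_app_nth)
qed simp

context
  fixes ys :: "nat list"
  assumes ys: "distinct ys" "set ys \<subseteq> {..<n}"
begin

lemma payoff_nonadaptive:
  assumes s: "\<And>i. i \<in> set ys \<Longrightarrow> 0 \<le> s i" "sum s (set ys) \<le> 1"
  shows "risky_payoff I (nonadaptive ys) s = sum v (set ys)"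
proof -
  \<comment> \<open>The payoff is read off after \<open>n\<close> steps, which must suffice to run
    through all of \<open>ys\<close>.\<close>
  have "length ys \<le> n"
    using ys card_mono[of "{..<n}" "set ys"] by (simp add: distinct_card)
  then show ?thesis
    using s ys by (simp add: risky_payoff_eq inserted_nonadaptive[OF ys(1) s] sum_list_distinct_conv_sum_set)
qed

lemma integrable_nonadaptive: "integrable (sizes I) (risky_payoff I (nonadaptive ys))"
  by (intro integrable_payoff nonadaptive_in_policies ys)

lemma nonadaptive_value_nonneg: "0 \<le> policy_value I (nonadaptive ys)"
  unfolding policy_value_def
  by (intro integral_nonneg_AE AE_I2 payoff_bounds nonadaptive_in_policies ys)

text \<open>Markov's inequality in pointwise form: 1 minus the truncated total is at most 1 always
  and at most 0 on overflow, so its product with the total value is almost surely below the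
  payoff.\<close>

lemma nonadaptive_value_ge:
  assumes le1: "sum \<mu> (set ys) \<le> 1"
  shows "sum w (set ys) * (1 - sum \<mu> (set ys)) \<le> policy_value I (nonadaptive ys)"
proof -
  let ?A = "set ys"
  have int: "integrable (sizes I) (\<lambda>s. min (s i) 1)" "(\<integral>s. min (s i) 1 \<partial>sizes I) = \<mu> i" if "i \<in> ?A" for i
    using integral_indep[of i "\<lambda>_. True" "\<lambda>x. min x 1"] integrable_truncated ys that
    by (auto simp: mean_size_eq S.prob_space)
  have "sum w ?A * (1 - sum \<mu> ?A) \<le> sum v ?A * (1 - sum \<mu> ?A)"
    using ys le1 by (intro mult_right_mono sum_mono eff_value_le) auto
  also have "\<dots> = (\<integral>s. sum v ?A * (1 - (\<Sum>i\<in>?A. min (s i) 1)) \<partial>sizes I)"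
    using int by (simp add: Bochner_Integration.integral_diff S.prob_space)
  also have "\<dots> \<le> policy_value I (nonadaptive ys)"
    unfolding policy_value_def
  proof (rule integral_mono_AE[OF _ integrable_nonadaptive])
    show "integrable (sizes I) (\<lambda>s. sum v ?A * (1 - (\<Sum>i\<in>?A. min (s i) 1)))"
      using int by (intro integrable_mult_right Bochner_Integration.integrable_diff
          Bochner_Integration.integrable_sum) auto
    show "AE s in sizes I. sum v ?A * (1 - (\<Sum>i\<in>?A. min (s i) 1)) \<le> risky_payoff I (nonadaptive ys) s"
      using AE_sizes_nonneg
    proof eventually_elim
      case (elim s)
      have s: "0 \<le> s i" if "i \<in> ?A" for i using elim that ys by auto
      have V: "0 \<le> sum v ?A" using ys by (auto intro!: sum_nonneg value_nonneg)
      have T: "0 \<le> (\<Sum>i\<in>?A. min (s i) 1)" using s by (auto intro!: sum_nonneg)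
      show ?case
      proof (cases "sum s ?A \<le> 1")
        case True
        then show ?thesis using V T by (simp add: payoff_nonadaptive s mult_left_le)
      next
        case False
        \<comment> \<open>Truncation does not hide an overflow: either one item alone reaches the
          cap, or no size is changed.\<close>
        have "1 \<le> (\<Sum>i\<in>?A. min (s i) 1)"
        proof (cases "\<exists>i\<in>?A. s i > 1")
          case True
          then obtain i where "i \<in> ?A" "s i > 1" by blast
          then show ?thesis
            using s member_le_sum[of i ?A "\<lambda>i. min (s i) 1"] by auto
        next
          case False
          then have "(\<Sum>i\<in>?A. min (s i) 1) = sum s ?A" by (intro sum.cong) auto
          with \<open>\<not> sum s ?A \<le> 1\<close> show ?thesis by simp
        qed
        then have "sum v ?A * (1 - (\<Sum>i\<in>?A. min (s i) 1)) \<le> 0"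
          using V by (simp add: mult_nonneg_nonpos)
        also have "0 \<le> risky_payoff I (nonadaptive ys) s"
          by (intro payoff_bounds nonadaptive_in_policies ys)
        finally show ?thesis .
      qed
    qed
  qed
  finally show ?thesis .
qed

text \<open>A single item overflows only when it does not fit by itself, so the Markov factor of
  \<open>nonadaptive_value_ge\<close> can be avoided.\<close>

lemma nonadaptive_value_single_ge:
  assumes i: "set ys = {i}"
  shows "w i \<le> policy_value I (nonadaptive ys)"
proof -
  have "i < n" using ys i by auto
  note int = integral_indep[OF this, of "\<lambda>_. True", OF _ _ integrable_fits]
  have "w i = (\<integral>s. v i * of_bool (s i \<le> 1) \<partial>sizes I)"
    using int \<open>i < n\<close> by (simp add: eff_value_eq S.prob_space)
  also have "\<dots> \<le> policy_value I (nonadaptive ys)"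
    unfolding policy_value_def
  proof (rule integral_mono_AE[OF _ integrable_nonadaptive])
    show "integrable (sizes I) (\<lambda>s. v i * of_bool (s i \<le> 1))"
      using int by (intro integrable_mult_right) simp
    show "AE s in sizes I. v i * of_bool (s i \<le> 1) \<le> risky_payoff I (nonadaptive ys) s"
      using AE_sizes_nonneg
    proof eventually_elim
      case (elim s)
      have "0 \<le> risky_payoff I (nonadaptive ys) s"
        by (intro payoff_bounds nonadaptive_in_policies ys)
      moreover have "risky_payoff I (nonadaptive ys) s = v i" if "s i \<le> 1"
        using payoff_nonadaptive[of s] i elim that \<open>i < n\<close> by simp
      ultimately show ?case by auto
    qed
  qed
  finally show ?thesis .
qed

end

section \<open>The greedy algorithm\<close>

text \<open>Turns comparisons in \<open>ennreal\<close> into the division-free inequalities required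
  by \<open>Phi_le_threshold\<close>. If \<open>\<mu> i = 0\<close>, the second one holds because
  \<open>w i > 0\<close> would give an infinite ratio, above the finite ratio of
  \<open>l\<close>.\<close>

lemma ratio_threshold:
  assumes "i < n" "l < n" "0 < \<mu> l"
  shows "ratio I l \<le> ratio I i \<Longrightarrow> w l / \<mu> l * \<mu> i \<le> w i"
    and "ratio I i \<le> ratio I l \<Longrightarrow> w i \<le> w l / \<mu> l * \<mu> i"
proof -
  have l: "ratio I l = ennreal (w l / \<mu> l)"
    using assms by (simp add: ratio_def divide_ennreal eff_value_nonneg)
  have pos: "ratio I i = ennreal (w i / \<mu> i)" if "0 < \<mu> i"
    using assms that by (simp add: ratio_def divide_ennreal eff_value_nonneg)
  have top: "ratio I i = \<top>" if "\<mu> i = 0" "0 < w i"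
    using that by (simp add: ratio_def divide_ennreal_def ennreal_mult_top)
  show "w l / \<mu> l * \<mu> i \<le> w i" if "ratio I l \<le> ratio I i"
  proof (cases "\<mu> i = 0")
    case False
    with assms have "0 < \<mu> i" using mean_size_nonneg[of i] by simp
    with that assms show ?thesis
      by (simp add: l pos ennreal_le_iff eff_value_nonneg le_divide_eq)
  qed (use assms in \<open>simp add: eff_value_nonneg\<close>)
  show "w i \<le> w l / \<mu> l * \<mu> i" if "ratio I i \<le> ratio I l"
  proof (cases "\<mu> i = 0")
    case True
    have "\<not> 0 < w i" using top[OF True] that l by (auto simp: top_unique)
    with True show ?thesis by simp
  next
    case False
    with assms have "0 < \<mu> i" using mean_size_nonneg[of i] by simp
    with that assms show ?thesis
      by (simp add: l pos ennreal_le_iff eff_value_nonneg divide_le_eq)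
  qed
qed

lemma greedy_spec:
  assumes "distinct xs" "greedy I xs = (B, l)"
  shows "l \<le> length xs" "B = set (take l xs)" "sum \<mu> B \<le> 1/2"
    "l < length xs \<Longrightarrow> 1/2 < sum \<mu> B + \<mu> (xs ! l)"
proof -
  let ?P = "\<lambda>(B, l). l \<le> length xs \<and> B = set (take l xs) \<and> sum \<mu> B \<le> 1/2"
  let ?b = "\<lambda>(B, l). l < length xs \<and> sum \<mu> B + \<mu> (xs ! l) \<le> 1/2"
  have "?P (greedy I xs) \<and> \<not> ?b (greedy I xs)"
    unfolding greedy_def
  proof (rule while_rule[where P = ?P and r = "Wellfounded.measure (\<lambda>(B, l). length xs - l)"])
    fix s assume "?P s" "?b s"
    \<comment> \<open>Distinctness makes the inserted item new, so the loop test really bounds the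
      mean size of the enlarged set.\<close>
    moreover have "xs ! m \<notin> set (take m xs)" if "m < length xs" for m
      using assms(1) that by (auto simp: in_set_conv_nth nth_eq_iff_index_eq)
    ultimately show "?P ((\<lambda>(B, l). (insert (xs ! l) B, Suc l)) s)"
      by (auto simp: take_Suc_conv_app_nth)
  qed auto
  with assms(2) show "l \<le> length xs" "B = set (take l xs)" "sum \<mu> B \<le> 1/2"
    "l < length xs \<Longrightarrow> 1/2 < sum \<mu> B + \<mu> (xs ! l)"
    by auto
qed

end

text \<open>
  The constant \<open>c = sqrt 5 - 2\<close> is the positive root of \<open>c\<^sup>2 + 4 c = 1\<close>, so \<open>x (1 - x) = c\<close>
  at \<open>x = (1 \<plusminus> c) / 2\<close>. If the other three scores are below \<open>c\<close>, then \<open>a < (1 - c) / 2\<close>,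
  \<open>b > (1 + c) / 2\<close> and \<open>g < c\<close>, which makes the second score at least \<open>c\<close>.
\<close>

lemma some_score_ge:
  fixes a b g c :: real
  assumes c: "c\<^sup>2 + 4 * c = 1" "0 < c" and a: "a \<le> 1/2" and b: "1/2 < b"
  shows "c \<le> a * (1 - a) \<or> c \<le> (b - g) * (1 - a) \<or> c \<le> g \<or> c \<le> b * (1 - b)"
proof (rule ccontr)
  assume "\<not> ?thesis"
  then have lt: "a * (1 - a) < c" "(b - g) * (1 - a) < c" "g < c" "b * (1 - b) < c" by auto
  have "c < 1" using c by (smt (verit) zero_le_power2)
  \<comment> \<open>The equation for \<open>c\<close> says \<open>(1 - c\<^sup>2) / 4 = c\<close>,
    which is the constant term of this factorization.\<close>
  have fac: "((1 + c) / 2 - x) * ((1 - c) / 2 - x) = c - x * (1 - x)" for x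
    using c(1) by (simp add: field_simps power2_eq_square)
  have "0 < ((1 + c) / 2 - a) * ((1 - c) / 2 - a)" using lt(1) fac by simp
  then have a': "a < (1 - c) / 2" using a c(2) by (simp add: zero_less_mult_iff)
  have "0 < ((1 + c) / 2 - b) * ((1 - c) / 2 - b)" using lt(4) fac by simp
  then have b': "(1 + c) / 2 < b" using b c(2) by (simp add: zero_less_mult_iff)
  have "(1 - c) / 2 * ((1 + c) / 2) \<le> (b - g) * (1 - a)"
    using a' b' lt(3) c(2) \<open>c < 1\<close> by (intro mult_mono) (simp_all add: field_simps)
  moreover have "(1 - c) / 2 * ((1 + c) / 2) = c"
    using fac[of 0] by (simp add: mult.commute)
  ultimately show False using lt(2) by simp
qed

section \<open>Performance of the output against the fractional optimum\<close>

context valid_knapsack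
begin

lemma algorithm_value_ge:
  assumes out: "algorithm_output I ys" and c: "c\<^sup>2 + 4 * c = 1" "0 < c"
  shows "set ys \<subseteq> {..<n}" "c * Phi I 1 \<le> policy_value I (nonadaptive ys)"
proof -
  obtain xs B l where xs: "sorted_items I xs" and gr: "greedy I xs = (B, l)" and ys: "distinct ys"
    and sel: "if l = length xs then set ys = B
         else \<exists>j. is_arg_max (score I B (xs ! l)) (\<lambda>j. j \<in> {1, 2, 3, 4}) j \<and>
                  set ys = candidate B (xs ! l) j"
    using out unfolding algorithm_output_def by blast
  have dxs: "distinct xs" and set_xs: "set xs = {..<n}"
    and sorted: "sorted_wrt (\<lambda>i j. ratio I i \<ge> ratio I j) xs"
    using xs by (auto simp: sorted_items_def)
  note g = greedy_spec[OF dxs gr]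
  have B: "B \<subseteq> {..<n}" using g(2) set_xs set_take_subset by metis
  have cq: "c < 1/4" using c(1) zero_less_power[OF c(2), of 2] by linarith
  have Phi0: "0 \<le> Phi I 1" by (simp add: Phi_nonneg)
  show sub: "set ys \<subseteq> {..<n}"
  proof (cases "l = length xs")
    case True
    then show ?thesis using sel B by simp
  next
    case False
    then have "xs ! l \<in> {..<n}" using g(1) nth_mem[of l xs] set_xs by simp
    then have "candidate B (xs ! l) j \<subseteq> {..<n}" for j
      using B by (simp add: candidate_def)
    then show ?thesis using sel False by auto
  qed
  note nonneg = nonadaptive_value_nonneg[OF ys sub]
  note ge = nonadaptive_value_ge[OF ys sub]
  show "c * Phi I 1 \<le> policy_value I (nonadaptive ys)"
  proof (cases "l = length xs")
    case True
    then have ysB: "set ys = B" "B = {..<n}" using sel g(2) set_xs by auto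
    \<comment> \<open>All items are in \<open>B\<close>, so price 0 is admissible. The Markov factor
      is at least 1/2, which exceeds \<open>c\<close>.\<close>
    have "Phi I 1 \<le> sum w B"
      using Phi_le_threshold[of B 0] ysB eff_value_nonneg by simp
    then have "c * Phi I 1 \<le> (1 - sum \<mu> B) * sum w B"
      using c cq g(3) Phi0 by (intro mult_mono) auto
    then show ?thesis using ge g(3) ysB by (simp add: mult.commute)
  next
    case False
    define i where "i = xs ! l"
    have l: "l < length xs" using False g(1) by simp
    then have i: "i < n" using set_xs i_def nth_mem by blast
    have iB: "i \<notin> B"
      using dxs l unfolding i_def g(2) by (auto simp: in_set_conv_nth nth_eq_iff_index_eq)
    define a where "a = sum \<mu> B"
    define b where "b = a + \<mu> i"
    define W where "W = sum w B"
    define F where "F = Phi I 1"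
    have a: "0 \<le> a" "a \<le> 1/2" and b: "1/2 < b"
      using g(3) g(4)[OF l] B mean_size_nonneg by (auto simp: a_def b_def i_def intro!: sum_nonneg)
    then have mi: "0 < \<mu> i" by (simp add: b_def)
    \<comment> \<open>The density of the critical item \<open>i\<close> serves as price for both
      prefixes, \<open>B\<close> and \<open>insert i B\<close>: at this price \<open>i\<close> has
      zero net value and may lie on either side of the threshold.\<close>
    define r where "r = w i / \<mu> i"
    have r: "0 \<le> r" "r * \<mu> i = w i" using mi i by (auto simp: r_def eff_value_nonneg)
    have before: "r * \<mu> m \<le> w m" if m: "m \<in> B" for m
    proof -
      obtain k where k: "k < l" "m = xs ! k" using m l unfolding g(2) by (auto simp: in_set_conv_nth)
      then have "ratio I i \<le> ratio I m" using sorted l by (simp add: sorted_wrt_iff_nth_less i_def)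
      then show ?thesis using that B i mi ratio_threshold(1)[of m i] by (auto simp: r_def)
    qed
    have after: "w m \<le> r * \<mu> m" if m: "m < n" "m \<notin> B" for m
    proof -
      obtain k where k: "k < length xs" "m = xs ! k" using m(1) set_xs by (metis in_set_conv_nth lessThan_iff)
      have "\<not> k < l" using that k l unfolding g(2) by (auto simp: in_set_conv_nth)
      then have "ratio I m \<le> ratio I i"
        using sorted k by (cases "k = l") (auto simp: sorted_wrt_iff_nth_less i_def)
      then show ?thesis using that i mi ratio_threshold(2)[of m i] by (auto simp: r_def)
    qed
    have finB: "finite B" using g(2) by simp
    have F1: "F \<le> W + r * (1 - a)"
      unfolding F_def W_def a_def using B before after r(1) by (intro Phi_le_threshold) auto
    have "F \<le> sum w (insert i B) + r * (1 - sum \<mu> (insert i B))"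
      unfolding F_def using B before after r i by (intro Phi_le_threshold) auto
    then have F2: "F \<le> W + w i + r * (1 - b)"
      using iB finB by (simp add: W_def a_def b_def add_ac)
    have ra: "r * a \<le> W" unfolding a_def W_def sum_distrib_left by (intro sum_mono before)
    have rb: "r * b \<le> W + w i" using ra r(2) by (simp add: b_def algebra_simps)
    \<comment> \<open>A greedy prefix of size \<open>t\<close> holds at least the fraction
      \<open>t\<close> of the optimum: averaging the two bounds with weights \<open>t\<close> and
      \<open>1 - t\<close> eliminates \<open>r\<close>.\<close>
    have F_scale: "t * F \<le> X" if "F \<le> X + r * (1 - t)" "r * t \<le> X" "0 \<le> t" "t \<le> 1" for X t
    proof -
      have "t * F \<le> t * (X + r * (1 - t))" using that by (intro mult_left_mono)
      also have "\<dots> = t * X + (1 - t) * (r * t)" by (simp add: algebra_simps)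
      also have "\<dots> \<le> t * X + (1 - t) * X" using that by (intro add_mono mult_left_mono) auto
      finally show ?thesis by (simp add: algebra_simps)
    qed
    have WB: "a * F \<le> W" using F_scale[OF F1 ra] a by simp
    have WBi: "b * F \<le> W + w i" if "b \<le> 1" using F_scale[OF F2 rb] b that by simp
    show ?thesis
    \<comment> \<open>Separated because \<gamma> divides by \<open>F\<close>; here nonnegativity of
      the payoff suffices.\<close>
    proof (cases "F = 0")
      case True
      then show ?thesis using nonneg by (simp add: F_def)
    next
      case False
      then have F: "0 < F" using Phi0 by (simp add: F_def)
      define \<gamma> where "\<gamma> = w i / F"
      have \<gamma>: "\<gamma> * F = w i" "0 \<le> \<gamma>" using F i by (auto simp: \<gamma>_def eff_value_nonneg)
      obtain j where j: "is_arg_max (score I B i) (\<lambda>j. j \<in> {1, 2, 3, 4}) j" "set ys = candidate B i j"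
        using sel \<open>l \<noteq> length xs\<close> by (auto simp: i_def)
      have scores: "score I B i 1 = a * (1 - a)" "score I B i 2 = (b - \<gamma>) * (1 - a)"
        "score I B i 3 = \<gamma>" "score I B i 4 = b * (1 - b)"
        by (simp_all add: score_def Let_def a_def b_def \<gamma>_def F_def)
      have max: "score I B i k \<le> score I B i j" if "k \<in> {1, 2, 3, 4}" for k
        using j(1) that unfolding is_arg_max_linorder by blast
      have cj: "c \<le> score I B i j"
        using some_score_ge[OF c a(2) b, of \<gamma>] max[of 1] max[of 2] max[of 3] max[of 4]
        unfolding scores by auto
      then have cF: "c * F \<le> score I B i j * F" using F by simp
      have "j \<in> {1, 2, 3, 4}" using j(1) by (simp add: is_arg_max_linorder)
      then consider "j = 1" | "j = 2" "b \<le> 1" | "j = 2" "1 < b" | "j = 3" | "j = 4" by fastforce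
      then have "c * F \<le> policy_value I (nonadaptive ys)"
      proof cases
        case 1
        then have ysB: "set ys = B" using j(2) by (simp add: candidate_def)
        have "c * F \<le> (a * F) * (1 - a)" using cF 1 scores by (simp add: mult_ac)
        also have "\<dots> \<le> W * (1 - a)" using WB a by (intro mult_right_mono) auto
        finally show ?thesis using ge a ysB by (simp add: W_def a_def)
      next
        case 2
        then have ysB: "set ys = B" using j(2) by (simp add: candidate_def)
        have "c * F \<le> ((b - \<gamma>) * F) * (1 - a)" using cF 2 scores by (simp add: mult_ac)
        \<comment> \<open>The larger prefix is worth at least \<open>b * F\<close>, and removing
          \<open>i\<close> costs exactly \<open>\<gamma> * F\<close>.\<close>
        also have "(b - \<gamma>) * F \<le> W" using WBi[OF 2(2)] \<gamma>(1) by (simp add: left_diff_distrib)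
        then have "((b - \<gamma>) * F) * (1 - a) \<le> W * (1 - a)" using a by (intro mult_right_mono) auto
        finally show ?thesis using ge a ysB by (simp add: W_def a_def)
      next
        case 3
        \<comment> \<open>For \<open>b > 1\<close> the second score is not a lower bound for \<open>W (1 - a) / F\<close>; that it is at
          least \<open>\<gamma>\<close> forces \<open>W \<ge> F / (2 - a)\<close> instead, which gives the factor \<open>1/3\<close>.\<close>
        then have ysB: "set ys = B" using j(2) by (simp add: candidate_def)
        have "\<gamma> \<le> (b - \<gamma>) * (1 - a)" using max[of 3] 3 scores by simp
        then have "\<gamma> * (2 - a) \<le> b * (1 - a)" by (simp add: algebra_simps)
        also have "\<dots> = \<mu> i - a * (b - 1)" by (simp add: b_def algebra_simps)
        also have "\<dots> \<le> \<mu> i" using a 3 by simp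
        finally have "\<gamma> * (2 - a) * F \<le> \<mu> i * F" using F by simp
        moreover have "\<gamma> * (2 - a) * F = r * (2 - a) * \<mu> i"
          using \<gamma>(1) r(2) by (simp add: mult_ac)
        ultimately have "(r * (2 - a)) * \<mu> i \<le> F * \<mu> i" by (metis mult.commute)
        then have "r * (2 - a) \<le> F" using mi by simp
        \<comment> \<open>Together with \<open>F1\<close> scaled by \<open>2 - a\<close>, this
          eliminates \<open>r\<close>.\<close>
        then have "(1 - a) * (r * (2 - a)) \<le> (1 - a) * F" using a by (intro mult_left_mono) auto
        moreover have "(2 - a) * F \<le> (2 - a) * (W + r * (1 - a))"
          using F1 a by (intro mult_left_mono) auto
        ultimately have WF: "F \<le> (2 - a) * W" by (simp add: algebra_simps)
        then have "0 < (2 - a) * W" using F by linarith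
        then have "0 < W" using a by (simp add: zero_less_mult_iff)
        have "c * F \<le> F / 3" using cq F by simp
        also have "\<dots> \<le> (2 - a) / 3 * W" using WF by simp
        \<comment> \<open>The inequality \<open>(2 - a) / 3 \<le> 1 - a\<close> is equivalent to
          \<open>a \<le> 1/2\<close>.\<close>
        also have "\<dots> \<le> (1 - a) * W" using a \<open>0 < W\<close> by (intro mult_right_mono) auto
        finally show ?thesis using ge a ysB by (simp add: W_def a_def mult.commute)
      next
        case 4
        then have "set ys = {i}" using j(2) by (simp add: candidate_def)
        then show ?thesis
          using nonadaptive_value_single_ge[OF ys sub] cF 4 scores \<gamma>(1) by simp
      next
        case 5
        then have ysB: "set ys = insert i B" using j(2) by (simp add: candidate_def)
        \<comment> \<open>The winning score is at least \<open>c > 0\<close>, which forces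
          \<open>b < 1\<close>; hence \<open>WBi\<close> and the Markov bound apply to
          \<open>insert i B\<close>.\<close>
        have "0 < b * (1 - b)" using cj c(2) 5 scores by simp
        then have "b < 1" using b by (simp add: zero_less_mult_iff)
        have "c * F \<le> (b * F) * (1 - b)" using cF 5 scores by (simp add: mult_ac)
        also have "\<dots> \<le> (W + w i) * (1 - b)" using WBi \<open>b < 1\<close> by (intro mult_right_mono) auto
        finally show ?thesis
          using ge ysB iB finB \<open>b < 1\<close> by (simp add: W_def a_def b_def add.commute)
      qed
      then show ?thesis by (simp add: F_def)
    qed
  qed
qed

end

theorem mainTheorem1:
  fixes I :: knapsack and ys :: "nat list"
  assumes "knapsack_instance I"
    and "algorithm_output I ys"
  shows "ADAPT I \<le> 2 * golden_ratio ^ 3 * policy_value I (nonadaptive ys)"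
proof -
  interpret valid_knapsack I by unfold_locales (rule assms)
  define c where "c = sqrt 5 - (2 :: real)"
  have c: "c\<^sup>2 + 4 * c = 1" "0 < c"
    by (auto simp: c_def power2_eq_square algebra_simps real_less_rsqrt)
  note alg = algorithm_value_ge[OF assms(2) c]
  have "golden_ratio ^ 3 = sqrt 5 + 2"
    by (simp add: golden_ratio_def power3_eq_cube field_simps)
  then have \<phi>: "golden_ratio ^ 3 * c = 1" "0 \<le> golden_ratio ^ 3"
    by (auto simp: c_def algebra_simps)
  \<comment> \<open>The output policy itself witnesses that the supremum is over a nonempty
    set.\<close>
  have "ADAPT I \<le> 2 * Phi I 1"
    using ADAPT_le nonadaptive_in_policies[OF alg(1)] by blast
  also have "\<dots> = 2 * golden_ratio ^ 3 * (c * Phi I 1)"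
    using \<phi>(1) by (simp add: mult.assoc[symmetric])
  also have "\<dots> \<le> 2 * golden_ratio ^ 3 * policy_value I (nonadaptive ys)"
    using \<phi>(2) alg(2) by (intro mult_left_mono) auto
  finally show ?thesis .
qed

end
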